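(* Let $d,q,s\ge 1$ be fixed integers. Let $(\mathbf{x}_t)$ be an $\mathbf{R}^d$-valued time series following the model $$\mathbf{x}_t = F(\mathbf{x}_{t-q},\dots,\mathbf{x}_{t-1})+\boldsymbol{\zeta}_t,\qquad \boldsymbol{\zeta}_t = G(\boldsymbol{\zeta}_{t-s},\dots,\boldsymbol{\zeta}_{t-1})\,\boldsymbol{\eta}_t,$$ where $F:\mathbf{R}^{d\times q}\to\mathbf{R}^d$, $G(\cdot)=\mathrm{diag}(G_1(\cdot),\dots,G_d(\cdot))$ with $G_i:\mathbf{R}^{d\times s}\to[0,\infty)$, and $\boldsymbol{\eta}_t$ is independent of the past observations and past residuals $(\mathbf{x}_u,\boldsymbol{\zeta}_u)_{u<t}$. For each $T$, let $\widehat F=\widehat F_T:\mathbf{R}^{d\times q}\to\mathbf{R}^d$ and $\widehat G_i=\widehat G_{i,T}:\mathbf{R}^{d\times s}\to\mathbf{R}$ ($i=1,\dots,d$) be estimators (random functions) of $F$ and $G_i$ computed from $\mathbf{x}_1,\dots,\mathbf{x}_T$, and let $\widehat P=\widehat P_T$ be the empirical cumulative distribution function of the normalized fitted residuals $\widehat{\boldsymbol{\eta}}_t$, $t=q+s+1,\dots,T$ (defined in the context). Assume: 1. The vectors $\boldsymbol{\eta}_t$, $t=1,2,\dots$, are independent and identically distributed with continuous cumulative distribution function $P:\mathbf{R}^d\to\mathbf{R}$, with $\mathbf{E}[\boldsymbol{\eta}_1]=0$ and $\mathrm{Var}(\boldsymbol{\eta}_{1,i})\le C$ for a constant $C$ and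 all $i=1,\dots,d$. 2. As $T\to\infty$, $\sup_{\mathbf{Y}\in\mathbf{R}^{d\times q}}\|\widehat F(\mathbf{Y})-F(\mathbf{Y})\|\to_p 0$, and $\sup_{\mathbf{Y}\in\mathbf{R}^{d\times s}}|\widehat G_i(\mathbf{Y})-G_i(\mathbf{Y})|\to_p 0$ for $i=1,\dots,d$. 3. For each $i=1,\dots,d$, $G_i$ is continuously differentiable with $\sup_{\mathbf{Y}\in\mathbf{R}^{d\times s}}\|\nabla_{\mathbf{Y}}G_i(\mathbf{Y})\|<\infty$, and there is a constant $c>0$ such that $\inf_{\mathbf{Y}\in\mathbf{R}^{d\times s}}|G_i(\mathbf{Y})|>c$ for $i=1,\dots,d$. Then, as $T\to\infty$, $$\sup_{\boldsymbol{y}\in\mathbf{R}^d}\bigl|\widehat P(\boldsymbol{y})-P(\boldsymbol{y})\bigr|\to_p 0.$$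
   Context: Notation: $\to_p$ denotes convergence in probability; $\|\cdot\|$ is the Euclidean norm; a list of $q$ (resp. $s$) vectors in $\mathbf{R}^d$ is identified with the $d\times q$ (resp. $d\times s$) matrix having them as columns; $\boldsymbol{\eta}_{t,i}$ denotes the $i$-th coordinate of $\boldsymbol{\eta}_t$. For vectors $\boldsymbol{a},\boldsymbol{y}\in\mathbf{R}^d$, $\boldsymbol{a}\le\boldsymbol{y}$ means $a_i\le y_i$ for all $i=1,\dots,d$, and $P(\boldsymbol{y})=\Pr(\boldsymbol{\eta}_1\le\boldsymbol{y})$. The series $\mathbf{x}_1,\dots,\mathbf{x}_T$ is observed; the residuals $\boldsymbol{\zeta}_t=\mathbf{x}_t-F(\mathbf{x}_{t-q},\dots,\mathbf{x}_{t-1})$ and $\boldsymbol{\eta}_t$ are unobserved. Fitted residuals: for $t=q+1,\dots,T$, $$\widehat{\boldsymbol{\zeta}}_t=\mathbf{x}_t-\widehat F(\mathbf{x}_{t-q},\dots,\mathbf{x}_{t-1}).$$ Normalized fitted residuals: with $\widehat G(\cdot)=\mathrm{diag}(\widehat G_1(\cdot),\dots,\widehat G_d(\cdot))$, for $t=q+s+1,\dots,T$, $$\widehat{\boldsymbol{\eta}}_t=\widehat G^{-1}(\widehat{\boldsymbol{\zeta}}_{t-s},\dots,\widehat{\boldsymbol{\zeta}}_{t-1})\,\widehat{\boldsymbol{\zeta}}_t,$$ where $\widehat G^{-1}(\cdot)$ is the matrix inverse of the diagonal matrix $\widehat G(\cdot)$ (the value assigned when this matrix is singular is immaterial). Empirical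 cumulative distribution function: for $\boldsymbol{y}\in\mathbf{R}^d$, $$\widehat P(\boldsymbol{y})=\frac{1}{T-q-s}\sum_{t=q+s+1}^{T}\mathbf{1}_{\widehat{\boldsymbol{\eta}}_t\le\boldsymbol{y}}.$$ *)

theory Defs
  imports "HOL-Probability.Probability"
begin

text \<open>
  A list of vectors in \<open>\<real>\<^sup>d\<close> indexed by \<open>'k\<close> has type \<open>real^'d^'k\<close>. Its norm and inner product are
  the Euclidean (Frobenius) ones of the matrix with these columns. The linear order on the finite
  index type gives the order of the columns. The window at time \<open>t\<close> is
  \<open>(z\<^bsub>t - K\<^esub>, ..., z\<^bsub>t - 1\<^esub>)\<close> with \<open>K = CARD('k)\<close>: the column at \<open>k\<close> has
  \<open>card {j. j < k}\<close> predecessors, hence lag \<open>K - card {j. j < k}\<close>.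
  Only times \<open>t > K\<close> are meaningful, so the subtraction on \<open>nat\<close> never truncates there.
\<close>

definition lag_window :: "(nat \<Rightarrow> 'a) \<Rightarrow> nat \<Rightarrow> 'a ^ ('k::{finite,linorder})" where
  "lag_window z t = (\<chi> k. z (t - (CARD('k) - card {j. j < k})))"

definition diag_matrix :: "('d::finite \<Rightarrow> real) \<Rightarrow> real^'d^'d" where
  "diag_matrix g = (\<chi> i j. if i = j then g i else 0)"

definition fitted_residual ::
  "(real^'d^('q::{finite,linorder}) \<Rightarrow> real^'d) \<Rightarrow> (nat \<Rightarrow> real^'d) \<Rightarrow> nat \<Rightarrow> real^'d" where
  "fitted_residual f x t = x t - f (lag_window x t)"

definition normalized_residual ::
  "(real^'d^('q::{finite,linorder}) \<Rightarrow> real^'d) \<Rightarrow> ('d \<Rightarrow> real^'d^('s::{finite,linorder}) \<Rightarrow> real)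
     \<Rightarrow> (nat \<Rightarrow> real^'d) \<Rightarrow> nat \<Rightarrow> real^'d" where
  "normalized_residual f g x t =
     matrix_inv (diag_matrix (\<lambda>i. g i (lag_window (fitted_residual f x) t))) *v fitted_residual f x t"

definition vec_cdf :: "'w measure \<Rightarrow> ('w \<Rightarrow> real^'d) \<Rightarrow> real^'d \<Rightarrow> real" where
  "vec_cdf M X y = measure M {\<omega> \<in> space M. X \<omega> \<le> y}"

text \<open>Empirical distribution function of \<open>e\<^bsub>m + 1\<^esub>, ..., e\<^bsub>T\<^esub>\<close>.\<close>

definition empirical_cdf :: "nat \<Rightarrow> nat \<Rightarrow> (nat \<Rightarrow> real^'d) \<Rightarrow> real^'d \<Rightarrow> real" where
  "empirical_cdf m T e y = (\<Sum>t\<in>{m+1..T}. of_bool (e t \<le> y)) / real (T - m)"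

definition observed :: "nat \<Rightarrow> (nat \<Rightarrow> 'w \<Rightarrow> 'a) \<Rightarrow> 'w \<Rightarrow> nat \<Rightarrow> 'a" where
  "observed T x \<omega> = (\<lambda>t\<in>{1..T}. x t \<omega>)"

text \<open>
  Convergence in probability to 0 of nonnegative, possibly infinite quantities. They arise as suprema
  over uncountable sets and need not be measurable, so the outer probability is used; for measurable
  \<open>Z n\<close> it coincides with the probability (\<open>outer_measure_of_eq\<close>).
\<close>

definition tendsto_zero_in_prob :: "'w measure \<Rightarrow> (nat \<Rightarrow> 'w \<Rightarrow> ennreal) \<Rightarrow> bool" where
  "tendsto_zero_in_prob M Z \<longleftrightarrow>
     (\<forall>\<epsilon>::real. \<epsilon> > 0 \<longrightarrow>
        (\<lambda>n. outer_measure_of M {\<omega> \<in> space M. Z n \<omega> > ennreal \<epsilon>}) \<longlonglongrightarrow> 0)"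

end

theory Submission
  imports Defs
begin

text \<open>
  Uniformly small estimation errors of \<open>F\<close> and \<open>G\<close> perturb the \<open>i\<close>-th coordinate of each normalized
  residual by at most a small multiple of \<open>1 + \<bar>\<eta>\<^sub>t\<^sub>,\<^sub>i\<bar>\<close>, because \<open>G\<close> is Lipschitz and bounded away
  from 0. Unless \<open>\<parallel>\<eta>\<^sub>t\<parallel> > A\<close>, which by the law of large numbers happens only for a small fraction of
  the times, the perturbation is thus at most a fixed small \<open>\<rho>\<close>. Moreover, up to the mass outside the
  ball of radius \<open>A\<close>, both distribution functions at \<open>y\<close> agree with those at the truncation of \<open>y\<close> to
  a compact cube. There, by continuity of \<open>P\<close>, finitely many pairs \<open>l \<le> u\<close> bracket all points with
  margin \<open>\<rho>\<close>, and the law of large numbers at these finitely many points finishes the proof.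
\<close>

subsection \<open>Perturbation of the residuals\<close>

text \<open>The Euclidean norm of a matrix is at most the sum of the norms of its columns. The lags
  run from 1 to \<open>CARD('k)\<close>, so only closeness at those times before \<open>t\<close>
  enters.\<close>

lemma norm_lag_window_diff_le:
  fixes z z' :: "nat \<Rightarrow> 'a::real_normed_vector"
  assumes "\<And>u. u < t \<Longrightarrow> t \<le> u + CARD('k::{finite,linorder}) \<Longrightarrow> norm (z u - z' u) \<le> \<delta>"
    and "t > CARD('k)"
  shows "norm (lag_window z t - (lag_window z' t :: 'a^('k::{finite,linorder}))) \<le> real CARD('k) * \<delta>"
proof -
  have bound: "norm (z (t - (CARD('k) - card {j. j < k})) - z' (t - (CARD('k) - card {j. j < k}))) \<le> \<delta>"
    for k :: 'k
  proof -
    have "card {j. j < k} < CARD('k)"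
      by (rule psubset_card_mono) auto
    then show ?thesis
      using assms(2) by (intro assms(1)) auto
  qed
  have "norm (lag_window z t - (lag_window z' t :: ('a, 'k) vec))
      \<le> (\<Sum>k\<in>(UNIV::'k set). norm ((lag_window z t - (lag_window z' t :: ('a, 'k) vec)) $ k))"
    unfolding norm_vec_def by (rule L2_set_le_sum) simp
  also have "\<dots> \<le> (\<Sum>k\<in>(UNIV::'k set). \<delta>)"
    by (rule sum_mono) (simp add: lag_window_def bound)
  finally show ?thesis by simp
qed

lemma diag_matrix_mult_nth: "(diag_matrix g *v v) $ i = g i * v $ i"
proof -
  have "(diag_matrix g *v v) $ i = (\<Sum>j\<in>UNIV. if j = i then g j * v $ j else 0)"
    unfolding diag_matrix_def matrix_vector_mult_def vec_lambda_beta by (rule sum.cong) auto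
  then show ?thesis by simp
qed

text \<open>\<open>matrix_inv\<close> chooses some two-sided inverse. The diagonal matrix of
  reciprocals shows that one exists, so the chosen matrix really inverts
  \<open>diag_matrix g\<close>, and coordinates can be compared.\<close>

lemma matrix_inv_diag_mult_nth:
  assumes "\<And>i. g i \<noteq> 0"
  shows "(matrix_inv (diag_matrix g) *v v) $ i = v $ i / g i"
proof -
  let ?D = "diag_matrix g" and ?E = "diag_matrix (\<lambda>i. 1 / g i)"
  have "?D ** ?E = mat 1" "?E ** ?D = mat 1"
    using assms by (auto simp: matrix_eq vec_eq_iff diag_matrix_mult_nth
        simp flip: matrix_vector_mul_assoc)
  then have "?D ** matrix_inv ?D = mat 1"
    unfolding matrix_inv_def by (rule someI2[where a = ?E, OF conjI]) auto
  then have "?D *v (matrix_inv ?D *v v) = v"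
    by (simp add: matrix_vector_mul_assoc)
  then have "g i * (matrix_inv ?D *v v) $ i = v $ i"
    by (metis diag_matrix_mult_nth)
  then show ?thesis
    using assms[of i] by (simp add: field_simps)
qed

text \<open>This is the deterministic core: errors in the numerator and in the scale are both of
  order \<open>\<delta>\<close>, and the estimated scale is at least \<open>c / 2\<close>. The error
  in the scale is multiplied by the innovation itself, hence a bound that grows with
  \<open>\<eta> t $ i\<close>.\<close>

lemma normalized_residual_close:
  fixes f F :: "real^'d^('q::{finite,linorder}) \<Rightarrow> real^'d"
    and g G :: "'d \<Rightarrow> real^'d^('s::{finite,linorder}) \<Rightarrow> real"
  assumes x: "\<And>t. t > CARD('q) \<Longrightarrow> x t = F (lag_window x t) + \<zeta> t"
    and \<zeta>: "\<And>t. t > CARD('q) + CARD('s) \<Longrightarrow>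
               \<zeta> t = diag_matrix (\<lambda>i. G i (lag_window \<zeta> t)) *v \<eta> t"
    and f: "\<And>Y. norm (f Y - F Y) \<le> \<delta>"
    and g: "\<And>i Y. \<bar>g i Y - G i Y\<bar> \<le> \<delta>"
    and lip: "\<And>i Y Y'. \<bar>G i Y - G i Y'\<bar> \<le> L * norm (Y - Y')" and L: "L \<ge> 0"
    and c: "c > 0" "\<And>i Y. G i Y \<ge> c" and \<delta>: "\<delta> \<le> c / 2"
    and t: "t > CARD('q) + CARD('s)"
  shows "\<bar>normalized_residual f g x t $ i - \<eta> t $ i\<bar>
          \<le> 2 * \<delta> / c * (1 + (1 + L * real CARD('s)) * \<bar>\<eta> t $ i\<bar>)"
proof -
  define z where "z = fitted_residual f x"
  \<comment> \<open>\<open>f\<close> and \<open>F\<close> are evaluated at the same observed window,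
    so the errors do not accumulate over time.\<close>
  have z_close: "norm (z u - \<zeta> u) \<le> \<delta>" if "u > CARD('q)" for u
  proof -
    have "z u - \<zeta> u = F (lag_window x u) - f (lag_window x u)"
      unfolding z_def fitted_residual_def by (subst x[OF that]) simp
    then show ?thesis using f by (simp add: norm_minus_commute)
  qed
  define W W' where "W = (lag_window z t :: (real^'d, 's) vec)"
    and "W' = (lag_window \<zeta> t :: (real^'d, 's) vec)"
  \<comment> \<open>Since \<open>t\<close> exceeds \<open>CARD('q) + CARD('s)\<close>, all times in
    the window exceed \<open>CARD('q)\<close>, where \<open>z_close\<close> applies.\<close>
  have "norm (W - W') \<le> real CARD('s) * \<delta>"
    unfolding W_def W'_def by (rule norm_lag_window_diff_le) (use t in \<open>auto intro!: z_close\<close>)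
  then have "L * norm (W - W') \<le> L * (real CARD('s) * \<delta>)"
    using L by (rule mult_left_mono)
  \<comment> \<open>Two errors add up: estimating \<open>G\<close> at the fitted window, and
    replacing the fitted window by the true one.\<close>
  then have "\<bar>g i W - G i W'\<bar> \<le> \<delta> + L * (real CARD('s) * \<delta>)"
    using g[of i W] lip[of i W W'] by linarith
  also have "\<dots> = \<delta> * (1 + L * real CARD('s))" by (simp add: algebra_simps)
  finally have gG: "\<bar>g i W - G i W'\<bar> \<le> \<delta> * (1 + L * real CARD('s))" .
  \<comment> \<open>With \<open>\<delta> \<le> c / 2\<close> the estimated scales stay positive, so
    the matrix inverse is a genuine one.\<close>
  have g_ge: "g j W \<ge> c / 2" for j
    using g[of j W] c(2)[of j W] \<delta> by linarith
  have g_pos: "g j W > 0" for j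
    using g_ge[of j] c(1) by linarith
  have nr: "normalized_residual f g x t $ i = z t $ i / g i W"
    unfolding normalized_residual_def W_def z_def[symmetric]
    by (rule matrix_inv_diag_mult_nth) (use g_pos in \<open>auto simp: W_def less_imp_neq[symmetric]\<close>)
  have \<zeta>i: "\<zeta> t $ i = G i W' * \<eta> t $ i"
    using \<zeta>[OF t] unfolding W'_def by (metis diag_matrix_mult_nth)
  \<comment> \<open>Multiplying the wanted difference by \<open>g i W\<close> avoids comparing two
    quotients with different denominators.\<close>
  have "\<bar>z t $ i - g i W * \<eta> t $ i\<bar> = \<bar>(z t - \<zeta> t) $ i - (g i W - G i W') * \<eta> t $ i\<bar>"
    by (simp add: \<zeta>i algebra_simps)
  also have "\<dots> \<le> \<bar>(z t - \<zeta> t) $ i\<bar> + \<bar>g i W - G i W'\<bar> * \<bar>\<eta> t $ i\<bar>"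
    unfolding abs_mult[symmetric] by (rule abs_triangle_ineq4)
  also have "\<dots> \<le> \<delta> + \<delta> * (1 + L * real CARD('s)) * \<bar>\<eta> t $ i\<bar>"
    by (intro add_mono mult_right_mono gG order_trans[OF component_le_norm_cart z_close])
       (use t in auto)
  finally have num: "\<bar>z t $ i - g i W * \<eta> t $ i\<bar> \<le> \<delta> * (1 + (1 + L * real CARD('s)) * \<bar>\<eta> t $ i\<bar>)"
    by (simp add: algebra_simps)
  have "\<bar>normalized_residual f g x t $ i - \<eta> t $ i\<bar> = \<bar>z t $ i - g i W * \<eta> t $ i\<bar> / g i W"
    using g_pos[of i] by (simp add: nr field_simps abs_divide)
  also have "\<dots> \<le> \<delta> * (1 + (1 + L * real CARD('s)) * \<bar>\<eta> t $ i\<bar>) / (c / 2)"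
    using num g_ge[of i] c(1) by (intro frac_le order_trans[OF abs_ge_zero num]) auto
  finally show ?thesis by (simp add: mult_ac)
qed

text \<open>Mean value inequality: by Cauchy-Schwarz the operator norm of the derivative is at most
  the norm of the gradient.\<close>

lemma GDERIV_bounded_imp_lipschitz:
  assumes "\<And>Y. GDERIV g Y :> g' Y" "\<And>Y. norm (g' Y) \<le> L"
  shows "\<bar>g Y - g Y'\<bar> \<le> L * norm (Y - Y')"
proof -
  have "norm (g Y - g Y') \<le> L * norm (Y - Y')"
  proof (rule differentiable_bound)
    show "(g has_derivative (\<lambda>h. h \<bullet> g' Z)) (at Z within UNIV)" for Z
      using assms(1)[of Z] by (simp add: gderiv_def)
    show "onorm (\<lambda>h. h \<bullet> g' Z) \<le> L" for Z
    proof (rule onorm_bound)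
      show "0 \<le> L" using assms(2)[of Z] norm_ge_zero[of "g' Z"] by linarith
      show "norm (h \<bullet> g' Z) \<le> L * norm h" for h
        using Cauchy_Schwarz_ineq2[of h "g' Z"]
          mult_left_mono[OF assms(2)[of Z], of "norm h"] by (simp add: mult.commute)
    qed
  qed auto
  then show ?thesis by simp
qed

subsection \<open>Comparison of empirical distribution functions\<close>

text \<open>General sets are allowed so that lower orthants and the exterior of a ball fall under
  one law of large numbers. The value is 0 when \<open>T \<le> m\<close>.\<close>

definition empirical_freq :: "nat \<Rightarrow> nat \<Rightarrow> (nat \<Rightarrow> 'a) \<Rightarrow> 'a set \<Rightarrow> real" where
  "empirical_freq m T e S = (\<Sum>t\<in>{m+1..T}. of_bool (e t \<in> S)) / real (T - m)"

lemma empirical_cdf_eq_freq: "empirical_cdf m T e y = empirical_freq m T e {..y}"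
  by (simp add: empirical_cdf_def empirical_freq_def)

text \<open>A union bound term by term. The sequences may differ, so that fitted residuals can be
  compared with true innovations.\<close>

lemma empirical_freq_le_add:
  assumes "\<And>t. t \<in> {m+1..T} \<Longrightarrow> e t \<in> S \<Longrightarrow> e' t \<in> S' \<or> e'' t \<in> S''"
  shows "empirical_freq m T e S \<le> empirical_freq m T e' S' + empirical_freq m T e'' S''"
  unfolding empirical_freq_def add_divide_distrib[symmetric] sum.distrib[symmetric]
  by (intro divide_right_mono sum_mono) (use assms in \<open>auto simp: of_bool_def\<close>)

text \<open>For \<open>B \<ge> 0\<close> this is the nearest-point projection onto the cube of
  half-side \<open>B\<close>.\<close>

definition truncate_vec :: "real \<Rightarrow> real^'d \<Rightarrow> real^'d" where
  "truncate_vec B y = (\<chi> i. max (-B) (min B (y $ i)))"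

lemma truncate_vec_in_cbox: "B \<ge> 0 \<Longrightarrow> truncate_vec B y \<in> cbox (\<chi> i. - B) (\<chi> i. B)"
  by (auto simp: truncate_vec_def mem_box_cart)

text \<open>Coordinates of \<open>z\<close> lie strictly inside the cube, so clamping
  \<open>y\<close> cannot alter a comparison. Strictness matters at the lower face, where
  \<open>y $ i < - B\<close> is raised to \<open>- B\<close>.\<close>

lemma le_truncate_vec_iff:
  assumes "norm z \<le> A" "A < B"
  shows "z \<le> truncate_vec B y \<longleftrightarrow> z \<le> y"
proof -
  have "z $ i \<le> max (-B) (min B (y $ i)) \<longleftrightarrow> z $ i \<le> y $ i" for i
    using component_le_norm_cart[of z i] assms by linarith
  then show ?thesis
    by (simp add: less_eq_vec_def truncate_vec_def)
qed

text \<open>The brackets surround the truncated point, so that finitely many pairs can serve all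
  \<open>y\<close>. The times with a large innovation, where closeness may fail, are paid for by the
  tail frequency.\<close>

lemma empirical_cdf_sandwich:
  fixes e e' :: "nat \<Rightarrow> real^'d"
  assumes close: "\<And>t i. t \<in> {m+1..T} \<Longrightarrow> norm (e t) \<le> A \<Longrightarrow> \<bar>e' t $ i - e t $ i\<bar> \<le> \<rho>"
    and AB: "A < B"
    and l: "\<And>i. l $ i \<le> truncate_vec B y $ i - \<rho>"
    and u: "\<And>i. truncate_vec B y $ i + \<rho> \<le> u $ i"
  shows "empirical_cdf m T e' y \<le> empirical_freq m T e {..u} + empirical_freq m T e {z. norm z > A}"
    and "empirical_freq m T e {..l} \<le> empirical_cdf m T e' y + empirical_freq m T e {z. norm z > A}"
proof -
  have *: "(e' t \<le> y \<longrightarrow> e t \<le> u) \<and> (e t \<le> l \<longrightarrow> e' t \<le> y)"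
    if t: "t \<in> {m+1..T}" "norm (e t) \<le> A" for t
  proof -
    \<comment> \<open>Within the cube the margin \<open>\<rho>\<close> absorbs the perturbation. If
      \<open>y $ i > B\<close>, the upper bound is automatic because
      \<open>e t $ i \<le> A < B\<close>; if \<open>y $ i < - B\<close>, then
      \<open>e t $ i \<le> l $ i\<close> is impossible.\<close>
    have "(e' t $ i \<le> y $ i \<longrightarrow> e t $ i \<le> u $ i) \<and> (e t $ i \<le> l $ i \<longrightarrow> e' t $ i \<le> y $ i)" for i
      using close[OF t, of i] l[of i] u[of i] AB t(2) component_le_norm_cart[of "e t" i]
      by (auto simp: truncate_vec_def max_def min_def split: if_splits)
    then show ?thesis by (auto simp: less_eq_vec_def)
  qed
  show "empirical_cdf m T e' y \<le> empirical_freq m T e {..u} + empirical_freq m T e {z. norm z > A}"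
    unfolding empirical_cdf_eq_freq by (rule empirical_freq_le_add) (use * in force)
  show "empirical_freq m T e {..l} \<le> empirical_cdf m T e' y + empirical_freq m T e {z. norm z > A}"
    unfolding empirical_cdf_eq_freq by (rule empirical_freq_le_add) (use * in force)
qed

text \<open>Around each point \<open>P\<close> varies little on some ball; compactness leaves
  finitely many centres, and each centre gives one bracket along the diagonal direction.\<close>

lemma finite_brackets:
  fixes P :: "real^'d \<Rightarrow> real"
  assumes "continuous_on UNIV P" "compact K" "\<epsilon> > 0"
  obtains N \<rho> where "finite N" "\<rho> > 0"
    "\<And>y. y \<in> K \<Longrightarrow> \<exists>(l, u)\<in>N. (\<forall>i. l $ i \<le> y $ i - \<rho> \<and> y $ i + \<rho> \<le> u $ i)
       \<and> \<bar>P l - P y\<bar> \<le> \<epsilon> \<and> \<bar>P u - P y\<bar> \<le> \<epsilon>"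
proof -
  \<comment> \<open>Moving along \<open>v\<close> shifts all coordinates equally, which yields the
    same margin in each of them.\<close>
  define v :: "real^'d" where "v = (\<chi> i. 1)"
  have "\<exists>r>0. \<forall>w. dist w z < r \<longrightarrow> \<bar>P w - P z\<bar> < \<epsilon> / 2" for z
    using assms(1,3) unfolding continuous_on_iff dist_real_def
    by (metis UNIV_I half_gt_zero)
  then obtain r where r: "\<And>z. r z > 0" "\<And>z w. dist w z < r z \<Longrightarrow> \<bar>P w - P z\<bar> < \<epsilon> / 2"
    by metis
  \<comment> \<open>The scaling keeps both bracket ends \<open>z - h z *\<^sub>R v\<close> and
    \<open>z + h z *\<^sub>R v\<close> in the ball of radius \<open>r z\<close>.\<close>
  define h where "h z = r z / (1 + norm v)" for z
  have v1: "1 + norm v > 0" by (smt (verit) norm_ge_zero)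
  have h: "h z > 0" "norm (h z *\<^sub>R v) < r z" "h z \<le> r z" for z
  proof -
    show "h z > 0" using r(1)[of z] v1 by (simp add: h_def)
    show "norm (h z *\<^sub>R v) < r z"
      using r(1)[of z] v1 by (simp add: h_def field_simps)
    show "h z \<le> r z"
      using r(1)[of z] v1 by (simp add: h_def field_simps)
  qed
  have "K \<subseteq> (\<Union>z\<in>K. ball z (h z / 2))"
    using h(1) by (auto intro!: bexI)
  then obtain D where D: "D \<subseteq> K" "finite D" "K \<subseteq> (\<Union>z\<in>D. ball z (h z / 2))"
    using compactE_image[OF assms(2), of K "\<lambda>z. ball z (h z / 2)"] by auto
  \<comment> \<open>Covering balls have half the radius \<open>h z\<close>; the other half remains
    as margin. Inserting 1 keeps the minimum defined when \<open>D\<close> is empty.\<close>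
  define \<rho> where "\<rho> = Min (insert 1 ((\<lambda>z. h z / 2) ` D))"
  have \<rho>: "\<rho> > 0" "\<And>z. z \<in> D \<Longrightarrow> \<rho> \<le> h z / 2"
  proof -
    show "\<rho> > 0"
      unfolding \<rho>_def using D(2) h(1) by (subst Min_gr_iff) auto
    show "\<rho> \<le> h z / 2" if "z \<in> D" for z
      unfolding \<rho>_def using D(2) that by (intro Min_le) auto
  qed
  show thesis
  proof (rule that[of "(\<lambda>z. (z - h z *\<^sub>R v, z + h z *\<^sub>R v)) ` D" \<rho>])
    show "finite ((\<lambda>z. (z - h z *\<^sub>R v, z + h z *\<^sub>R v)) ` D)" using D(2) by simp
    fix y assume "y \<in> K"
    then obtain z where z: "z \<in> D" "dist z y < h z / 2" using D(3) by auto
    have yz: "\<bar>y $ i - z $ i\<bar> < h z / 2" for i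
      using component_le_norm_cart[of "y - z" i] z(2) by (simp add: dist_norm norm_minus_commute)
    have "dist y z < r z"
      using z(2) h(1,3)[of z] by (simp add: dist_commute)
    then have "\<bar>P y - P z\<bar> < \<epsilon> / 2" by (rule r(2))
    moreover have "\<bar>P (z - h z *\<^sub>R v) - P z\<bar> < \<epsilon> / 2" "\<bar>P (z + h z *\<^sub>R v) - P z\<bar> < \<epsilon> / 2"
      using h(2)[of z] by (intro r(2); simp add: dist_norm)+
    ultimately have "\<bar>P (z - h z *\<^sub>R v) - P y\<bar> \<le> \<epsilon>" "\<bar>P (z + h z *\<^sub>R v) - P y\<bar> \<le> \<epsilon>"
      by linarith+
    moreover have "(z - h z *\<^sub>R v) $ i \<le> y $ i - \<rho> \<and> y $ i + \<rho> \<le> (z + h z *\<^sub>R v) $ i" for i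
      using yz[of i] \<rho>(2)[OF z(1)] by (intro conjI; simp add: v_def; linarith)
    ultimately show "\<exists>(l, u)\<in>(\<lambda>z. (z - h z *\<^sub>R v, z + h z *\<^sub>R v)) ` D.
       (\<forall>i. l $ i \<le> y $ i - \<rho> \<and> y $ i + \<rho> \<le> u $ i) \<and> \<bar>P l - P y\<bar> \<le> \<epsilon> \<and> \<bar>P u - P y\<bar> \<le> \<epsilon>"
      using z(1) by (intro bexI[of _ "(z - h z *\<^sub>R v, z + h z *\<^sub>R v)"]) auto
  qed (use \<rho> in auto)
qed

subsection \<open>Outer probability and the law of large numbers\<close>

text \<open>Each set has a measurable cover of the same outer measure, and subadditivity applies to
  the covers.\<close>

lemma outer_measure_of_Un_le:
  assumes "A \<subseteq> space M" "B \<subseteq> space M"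
  shows "outer_measure_of M (A \<union> B) \<le> outer_measure_of M A + outer_measure_of M B"
proof -
  obtain E where E: "E \<in> sets M" "A \<subseteq> E" "outer_measure_of M A = emeasure M E"
    using outer_measure_of_attain[OF assms(1)] by auto
  obtain E' where E': "E' \<in> sets M" "B \<subseteq> E'" "outer_measure_of M B = emeasure M E'"
    using outer_measure_of_attain[OF assms(2)] by auto
  have "outer_measure_of M (A \<union> B) \<le> outer_measure_of M (E \<union> E')"
    by (rule outer_measure_of_mono) (use E E' in auto)
  also have "\<dots> = emeasure M (E \<union> E')"
    using E E' by simp
  also have "\<dots> \<le> emeasure M E + emeasure M E'"
    by (rule emeasure_subadditive) (use E E' in auto)
  finally show ?thesis using E E' by simp
qed

lemma outer_measure_of_Un_tendsto_0:
  assumes "\<And>n. A n \<subseteq> space M" "\<And>n. B n \<subseteq> space M"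
    and "(\<lambda>n::nat. outer_measure_of M (A n)) \<longlonglongrightarrow> 0" "(\<lambda>n. outer_measure_of M (B n)) \<longlonglongrightarrow> 0"
  shows "(\<lambda>n. outer_measure_of M (A n \<union> B n)) \<longlonglongrightarrow> 0"
proof (rule tendsto_sandwich[OF _ _ tendsto_const])
  show "(\<lambda>n. outer_measure_of M (A n) + outer_measure_of M (B n)) \<longlonglongrightarrow> 0"
    using tendsto_add[OF assms(3,4)] by simp
qed (auto intro!: always_eventually outer_measure_of_Un_le assms)

lemma outer_measure_of_UN_tendsto_0:
  assumes "finite I" "\<And>i n. i \<in> I \<Longrightarrow> A i n \<subseteq> space M"
    and "\<And>i. i \<in> I \<Longrightarrow> (\<lambda>n::nat. outer_measure_of M (A i n)) \<longlonglongrightarrow> 0"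
  shows "(\<lambda>n. outer_measure_of M (\<Union>i\<in>I. A i n)) \<longlonglongrightarrow> 0"
  using assms
proof (induction I rule: finite_induct)
  case (insert i I)
  have "(\<lambda>n. outer_measure_of M (A i n \<union> (\<Union>i\<in>I. A i n))) \<longlonglongrightarrow> 0"
    by (rule outer_measure_of_Un_tendsto_0) (use insert in auto)
  then show ?case by simp
qed simp

text \<open>The indicators of \<open>S\<close> are i.i.d. with values in the unit interval, so
  Hoeffding's inequality gives an exponentially small bound.\<close>

lemma (in prob_space) weak_law_empirical_freq:
  fixes \<eta> :: "nat \<Rightarrow> 'a \<Rightarrow> 'b::topological_space"
  assumes indep: "indep_vars (\<lambda>_. borel) \<eta> {1..}"
    and ident: "\<And>t. t \<ge> 1 \<Longrightarrow> distr M borel (\<eta> t) = distr M borel (\<eta> 1)"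
    and S: "S \<in> sets borel" and \<tau>: "\<tau> > 0"
  shows "(\<lambda>T. outer_measure_of M {\<omega> \<in> space M.
            \<bar>empirical_freq m T (\<lambda>t. \<eta> t \<omega>) S - prob {\<omega> \<in> space M. \<eta> 1 \<omega> \<in> S}\<bar> \<ge> \<tau>}) \<longlonglongrightarrow> 0"
proof -
  define X where "X t \<omega> = (indicator S (\<eta> t \<omega>) :: real)" for t \<omega>
  have rv: "\<eta> t \<in> borel_measurable M" if "t \<ge> 1" for t
    using indep that unfolding indep_vars_def by auto
  have X_rv: "X t \<in> borel_measurable M" if "t \<ge> 1" for t
    unfolding X_def using rv[OF that] S by measurable
  have distr_X: "distr M borel (X t) = distr M borel (X 1)" if "t \<ge> 1" for t
  proof -
    have "distr M borel (X t) = distr (distr M borel (\<eta> t)) borel (indicator S)" if "t \<ge> 1" for t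
    proof -
      have "X t = indicator S \<circ> \<eta> t" by (simp add: X_def fun_eq_iff)
      then show ?thesis
        using distr_distr[OF borel_measurable_indicator[OF S] rv[OF that]] by metis
    qed
    from this[OF that] this[of 1] show ?thesis by (simp add: ident[OF that])
  qed
  have exp_X: "expectation (X 1) = prob {\<omega> \<in> space M. \<eta> 1 \<omega> \<in> S}"
  proof -
    have "expectation (X 1) = expectation (indicator {\<omega> \<in> space M. \<eta> 1 \<omega> \<in> S})"
      by (intro Bochner_Integration.integral_cong) (auto simp: X_def indicator_def)
    then show ?thesis using rv[of 1] S by simp
  qed
  define n where "n T = real (T - m)" for T
  have bound: "outer_measure_of M {\<omega> \<in> space M.
            \<bar>empirical_freq m T (\<lambda>t. \<eta> t \<omega>) S - prob {\<omega> \<in> space M. \<eta> 1 \<omega> \<in> S}\<bar> \<ge> \<tau>}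
          \<le> ennreal (2 * exp (-2 * n T * \<tau>\<^sup>2))" if T: "T > m" for T
  proof -
    interpret H: Hoeffding_ineq_iid M "{m+1..T}" X "X 1" 0 1 "expectation (X 1)"
    proof unfold_locales
      show "indep_vars (\<lambda>_. borel) X {m+1..T}"
        unfolding X_def
        by (rule indep_vars_compose2[OF indep_vars_subset[OF indep]]) (use S in auto)
      show "distr M borel (X t) = distr M borel (X 1)" if "t \<in> {m+1..T}" for t
        using that by (intro distr_X) auto
    qed (auto simp: X_rv X_def indicator_def)
    have fr: "empirical_freq m T (\<lambda>t. \<eta> t \<omega>) S = (\<Sum>t\<in>{m+1..T}. X t \<omega>) / n T" for \<omega>
      by (simp add: empirical_freq_def X_def n_def indicator_def of_bool_def)
    have card: "real (card {m+1..T}) = n T" by (simp add: n_def)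
    have "prob {\<omega> \<in> space M. \<bar>(\<Sum>t\<in>{m+1..T}. X t \<omega>) / n T - expectation (X 1)\<bar> \<ge> \<tau>}
          \<le> 2 * exp (-2 * n T * \<tau>\<^sup>2)"
      using H.Hoeffding_ineq_abs_ge'[of \<tau>] T \<tau> unfolding card by simp
    moreover have "{\<omega> \<in> space M. \<bar>(\<Sum>t\<in>{m+1..T}. X t \<omega>) / n T - expectation (X 1)\<bar> \<ge> \<tau>} \<in> sets M"
      using H.random_variable by measurable
    ultimately show ?thesis
      unfolding fr exp_X[symmetric] by (simp add: emeasure_eq_measure ennreal_leI)
  qed
  have "(\<lambda>T. 2 * exp (-2 * n T * \<tau>\<^sup>2)) \<longlonglongrightarrow> 0"
  \<comment> \<open>Shifting by \<open>m\<close> removes the truncated subtraction and leaves a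
    geometric sequence.\<close>
  proof (rule LIMSEQ_offset[of _ m])
    have "(\<lambda>T. 2 * exp (-2 * \<tau>\<^sup>2) ^ T) \<longlonglongrightarrow> 2 * 0"
      using \<tau> by (intro tendsto_mult tendsto_const LIMSEQ_realpow_zero) auto
    then show "(\<lambda>T. 2 * exp (-2 * n (T + m) * \<tau>\<^sup>2)) \<longlonglongrightarrow> 0"
      by (simp add: n_def mult_ac flip: exp_of_nat_mult)
  qed
  then have lim: "(\<lambda>T. ennreal (2 * exp (-2 * n T * \<tau>\<^sup>2))) \<longlonglongrightarrow> 0"
    using tendsto_ennrealI by fastforce
  show ?thesis
    by (rule tendsto_sandwich[OF _ eventually_mono[OF eventually_gt_at_top bound] tendsto_const lim]) auto
qed

section \<open>Tails and truncation of the population distribution\<close>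

lemma (in prob_space) tail_prob_small:
  fixes X :: "'a \<Rightarrow> 'b::{banach, second_countable_topology}"
  assumes "integrable M X" "\<epsilon> > 0"
  obtains A :: real where "A > 0" "prob {\<omega> \<in> space M. norm (X \<omega>) > A} \<le> \<epsilon>"
proof -
  define J where "J = expectation (\<lambda>\<omega>. norm (X \<omega>))"
  have J: "J \<ge> 0" by (simp add: J_def)
  \<comment> \<open>Markov's inequality gives \<open>J / A \<le> \<epsilon>\<close> for this
    \<open>A\<close>; the added 1 keeps \<open>A\<close> positive when \<open>J = 0\<close>.\<close>
  define A where "A = (J + 1) / \<epsilon>"
  have A: "A > 0" using J assms(2) by (simp add: A_def)
  have [measurable]: "X \<in> borel_measurable M" using assms(1) by simp
  have "prob {\<omega> \<in> space M. norm (X \<omega>) > A} \<le> prob {\<omega> \<in> space M. norm (X \<omega>) \<ge> A}"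
    by (rule finite_measure_mono) auto
  also have "\<dots> \<le> J / A"
    unfolding J_def
    by (rule integral_Markov_inequality_measure[where A = "{}"]) (use assms A in auto)
  also have "\<dots> \<le> \<epsilon>"
    using J assms(2) by (simp add: A_def field_simps)
  finally show thesis using A that by blast
qed

text \<open>Where \<open>norm (X \<omega>) \<le> A\<close> the two events coincide, so their
  probabilities differ by at most that of the exterior.\<close>

lemma (in prob_space) vec_cdf_truncate:
  fixes X :: "'a \<Rightarrow> real^'d"
  assumes X: "X \<in> borel_measurable M" and AB: "A < B"
  shows "\<bar>vec_cdf M X (truncate_vec B y) - vec_cdf M X y\<bar> \<le> prob {\<omega> \<in> space M. norm (X \<omega>) > A}"
proof -
  have [measurable]: "{\<omega> \<in> space M. X \<omega> \<le> w} \<in> events" for w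
    using measurable_sets_Collect[OF X, of "\<lambda>z. z \<le> w"] by (simp flip: atMost_def)
  have [measurable]: "{\<omega> \<in> space M. norm (X \<omega>) > A} \<in> events"
    using X by measurable
  have "prob {\<omega> \<in> space M. X \<omega> \<le> w} \<le> prob {\<omega> \<in> space M. X \<omega> \<le> w'} + prob {\<omega> \<in> space M. norm (X \<omega>) > A}"
    if "\<And>z. norm z \<le> A \<Longrightarrow> z \<le> w \<Longrightarrow> z \<le> w'" for w w'
  proof -
    have "prob {\<omega> \<in> space M. X \<omega> \<le> w} \<le> prob ({\<omega> \<in> space M. X \<omega> \<le> w'} \<union> {\<omega> \<in> space M. norm (X \<omega>) > A})"
      by (rule finite_measure_mono) (use that in \<open>force+\<close>)
    also have "\<dots> \<le> prob {\<omega> \<in> space M. X \<omega> \<le> w'} + prob {\<omega> \<in> space M. norm (X \<omega>) > A}"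
      by (rule measure_Un_le) auto
    finally show ?thesis .
  qed
  from this[of y "truncate_vec B y"] this[of "truncate_vec B y" y] show ?thesis
    unfolding vec_cdf_def abs_le_iff using le_truncate_vec_iff[OF _ AB] by fastforce
qed

theorem theorem4p1:
  fixes M :: "'w measure"
    and x \<zeta> \<eta> :: "nat \<Rightarrow> 'w \<Rightarrow> real^'d"
    and F :: "real^'d^('q::{finite,linorder}) \<Rightarrow> real^'d"
    and G :: "'d \<Rightarrow> real^'d^('s::{finite,linorder}) \<Rightarrow> real"
    and gradG :: "'d \<Rightarrow> real^'d^('s::{finite,linorder}) \<Rightarrow> real^'d^('s::{finite,linorder})"
    and Fhat :: "nat \<Rightarrow> (nat \<Rightarrow> real^'d) \<Rightarrow> real^'d^('q::{finite,linorder}) \<Rightarrow> real^'d"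
    and Ghat :: "nat \<Rightarrow> (nat \<Rightarrow> real^'d) \<Rightarrow> 'd \<Rightarrow> real^'d^('s::{finite,linorder}) \<Rightarrow> real"
    and c C :: real
  assumes prob: "prob_space M"
    and x_rv: "\<And>t. t \<ge> 1 \<Longrightarrow> x t \<in> borel_measurable M"
    and zeta_rv: "\<And>t. t \<ge> 1 \<Longrightarrow> \<zeta> t \<in> borel_measurable M"
    and x_model: "\<And>t. t > CARD('q) \<Longrightarrow>
          AE \<omega> in M. x t \<omega> = F (lag_window (\<lambda>u. x u \<omega>) t) + \<zeta> t \<omega>"
    and zeta_model: "\<And>t. t > CARD('q) + CARD('s) \<Longrightarrow>
          AE \<omega> in M. \<zeta> t \<omega> = diag_matrix (\<lambda>i. G i (lag_window (\<lambda>u. \<zeta> u \<omega>) t)) *v \<eta> t \<omega>"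
    and G_nonneg: "\<And>i Y. G i Y \<ge> 0"
    and eta_indep_past: "\<And>t. t \<ge> 1 \<Longrightarrow>
          prob_space.indep_set M
            (sets (vimage_algebra (space M) (\<eta> t) borel))
            (sets (vimage_algebra (space M) (\<lambda>\<omega>. \<lambda>u\<in>{1..<t}. (x u \<omega>, \<zeta> u \<omega>))
                     (\<Pi>\<^sub>M u\<in>{1..<t}. borel)))"
    and Fhat_rv: "\<And>T Y. (\<lambda>z. Fhat T z Y) \<in> borel_measurable (\<Pi>\<^sub>M t\<in>{1..T}. borel)"
    and Ghat_rv: "\<And>T i Y. (\<lambda>z. Ghat T z i Y) \<in> borel_measurable (\<Pi>\<^sub>M t\<in>{1..T}. borel)"
    and eta_indep: "prob_space.indep_vars M (\<lambda>_. borel) \<eta> {1..}"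
    and eta_ident: "\<And>t. t \<ge> 1 \<Longrightarrow> distr M borel (\<eta> t) = distr M borel (\<eta> 1)"
    and P_cont: "continuous_on UNIV (vec_cdf M (\<eta> 1))"
    and eta_integrable: "integrable M (\<eta> 1)"
    and eta_mean: "prob_space.expectation M (\<eta> 1) = 0"
    and eta_square_integrable: "\<And>i. integrable M (\<lambda>\<omega>. (\<eta> 1 \<omega> $ i)\<^sup>2)"
    and eta_var: "\<And>i. prob_space.variance M (\<lambda>\<omega>. \<eta> 1 \<omega> $ i) \<le> C"
    and Fhat_consistent: "tendsto_zero_in_prob M
          (\<lambda>T \<omega>. SUP Y. ennreal (norm (Fhat T (observed T x \<omega>) Y - F Y)))"
    and Ghat_consistent: "\<And>i. tendsto_zero_in_prob M
          (\<lambda>T \<omega>. SUP Y. ennreal \<bar>Ghat T (observed T x \<omega>) i Y - G i Y\<bar>)"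
    and G_grad: "\<And>i Y. GDERIV (G i) Y :> gradG i Y"
    and G_grad_cont: "\<And>i. continuous_on UNIV (gradG i)"
    and G_grad_bdd: "\<And>i. bdd_above (range (\<lambda>Y. norm (gradG i Y)))"
    and c_pos: "c > 0"
    and G_lower: "\<And>i. (INF Y. \<bar>G i Y\<bar>) > c"
  shows "tendsto_zero_in_prob M
          (\<lambda>T \<omega>. SUP y. ennreal
             \<bar>empirical_cdf (CARD('q) + CARD('s)) T
                (normalized_residual (Fhat T (observed T x \<omega>)) (Ghat T (observed T x \<omega>))
                   (\<lambda>t. x t \<omega>)) y
              - vec_cdf M (\<eta> 1) y\<bar>)"
proof -
  interpret prob_space M by (rule prob)
  define m where "m = CARD('q) + CARD('s)"
  define P where "P = vec_cdf M (\<eta> 1)"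
  define bad_F where "bad_F \<delta> T = {\<omega> \<in> space M.
      (SUP Y. ennreal (norm (Fhat T (observed T x \<omega>) Y - F Y))) > ennreal \<delta>}" for \<delta> T
  define bad_G where "bad_G \<delta> i T = {\<omega> \<in> space M.
      (SUP Y. ennreal \<bar>Ghat T (observed T x \<omega>) i Y - G i Y\<bar>) > ennreal \<delta>}" for \<delta> i T
  define bad_freq where "bad_freq \<tau> S T = {\<omega> \<in> space M.
      \<bar>empirical_freq m T (\<lambda>t. \<eta> t \<omega>) S - prob {\<omega> \<in> space M. \<eta> 1 \<omega> \<in> S}\<bar> \<ge> \<tau>}" for \<tau> S T

  \<comment> \<open>Lipschitz constant and lower bound for the scales\<close>
  have eta_rv: "\<eta> 1 \<in> borel_measurable M"
    using eta_integrable by simp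
  have "\<exists>B. \<forall>Y. norm (gradG i Y) \<le> B" for i
    using G_grad_bdd[of i] by (auto simp: bdd_above_def)
  then obtain B where B: "\<And>i Y. norm (gradG i Y) \<le> B i" by metis
  \<comment> \<open>Summing the nonnegative bounds yields one Lipschitz constant for all
    coordinates.\<close>
  define L where "L = (\<Sum>i\<in>UNIV. B i)"
  have B_nonneg: "B i \<ge> 0" for i
    using B[of i] norm_ge_zero order_trans by blast
  then have L_nonneg: "L \<ge> 0" unfolding L_def by (rule sum_nonneg)
  have "B i \<le> L" for i
    unfolding L_def by (rule member_le_sum) (auto simp: B_nonneg)
  then have lip: "\<bar>G i Y - G i Y'\<bar> \<le> L * norm (Y - Y')" for i Y Y'
    by (intro GDERIV_bounded_imp_lipschitz[OF G_grad] order_trans[OF B])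
  have G_ge: "G i Y \<ge> c" for i Y
  proof -
    have "(INF Y. \<bar>G i Y\<bar>) \<le> \<bar>G i Y\<bar>"
      by (rule cINF_lower) (auto intro!: bdd_belowI[of _ 0])
    then show ?thesis using G_lower[of i] G_nonneg[of i Y] by simp
  qed

  \<comment> \<open>There are countably many times, so one null set \<open>N\<close> carries all
    failures of the model equations.\<close>
  have "AE \<omega> in M. (\<forall>t>CARD('q). x t \<omega> = F (lag_window (\<lambda>u. x u \<omega>) t) + \<zeta> t \<omega>) \<and>
      (\<forall>t>m. \<zeta> t \<omega> = diag_matrix (\<lambda>i. G i (lag_window (\<lambda>u. \<zeta> u \<omega>) t)) *v \<eta> t \<omega>)"
    using x_model zeta_model by (simp add: AE_conj_iff AE_all_countable m_def)
  then obtain N where N: "{\<omega> \<in> space M. \<not> ((\<forall>t>CARD('q). x t \<omega> = F (lag_window (\<lambda>u. x u \<omega>) t) + \<zeta> t \<omega>) \<and>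
      (\<forall>t>m. \<zeta> t \<omega> = diag_matrix (\<lambda>i. G i (lag_window (\<lambda>u. \<zeta> u \<omega>) t)) *v \<eta> t \<omega>))} \<subseteq> N"
      "emeasure M N = 0" "N \<in> sets M"
    by (rule AE_E)

  show ?thesis
    unfolding tendsto_zero_in_prob_def
  proof (intro allI impI)

    \<comment> \<open>Choice of the constants for a given precision\<close>
    fix \<epsilon> :: real assume "\<epsilon> > 0"
    \<comment> \<open>The budget of five: one each for truncation, bracketing and the frequency at a
      bracket end, two for the tail frequency.\<close>
    define \<tau> where "\<tau> = \<epsilon> / 5"
    have \<tau>: "\<tau> > 0" using \<open>\<epsilon> > 0\<close> by (simp add: \<tau>_def)
    obtain A where A: "A > 0" "prob {\<omega> \<in> space M. norm (\<eta> 1 \<omega>) > A} \<le> \<tau>"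
      using tail_prob_small[OF eta_integrable \<tau>] by blast
    define K :: "(real^'d) set" where "K = cbox (\<chi> i. - (A + 1)) (\<chi> i. A + 1)"
    have "compact K" by (simp add: K_def)
    obtain Br \<rho> where Br: "finite Br" and \<rho>: "\<rho> > 0" and brackets:
      "\<And>y. y \<in> K \<Longrightarrow> \<exists>(l, u)\<in>Br. (\<forall>i. l $ i \<le> y $ i - \<rho> \<and> y $ i + \<rho> \<le> u $ i)
         \<and> \<bar>P l - P y\<bar> \<le> \<tau> \<and> \<bar>P u - P y\<bar> \<le> \<tau>"
      by (rule finite_brackets[OF P_cont[folded P_def] \<open>compact K\<close> \<tau>]) (rule that)
    define tail :: "(real^'d) set" where "tail = {z. norm z > A}"
    define \<S> where "\<S> = insert tail (atMost ` (fst ` Br \<union> snd ` Br))"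
    \<comment> \<open>\<open>D\<close> bounds the growth factor of the perturbation when the
      innovation has norm at most \<open>A\<close>; \<open>\<delta>\<close> is then chosen to make
      the perturbation at most \<open>\<rho>\<close>.\<close>
    define D where "D = 1 + (1 + L * real CARD('s)) * A"
    have D: "D > 0"
      using L_nonneg A(1) by (auto simp: D_def intro!: add_pos_nonneg mult_nonneg_nonneg)
    define \<delta> where "\<delta> = min (c / 2) (\<rho> * c / (2 * D))"
    have \<delta>: "\<delta> > 0" "\<delta> \<le> c / 2" "2 * \<delta> / c * D \<le> \<rho>"
    proof -
      show "\<delta> > 0" "\<delta> \<le> c / 2" using c_pos \<rho> D by (auto simp: \<delta>_def)
      have "\<delta> \<le> \<rho> * c / (2 * D)" by (simp add: \<delta>_def)
      then show "2 * \<delta> / c * D \<le> \<rho>" using c_pos D by (simp add: field_simps)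
    qed
    define bad where "bad T = (N \<union> bad_F \<delta> T) \<union>
        ((\<Union>i\<in>UNIV. bad_G \<delta> i T) \<union> (\<Union>S\<in>\<S>. bad_freq \<tau> S T))" for T

    \<comment> \<open>Vanishing outer probability of the bad event\<close>
    have "tail \<in> sets borel" unfolding tail_def by measurable
    then have sets_S: "S \<in> sets borel" if "S \<in> \<S>" for S
      using that by (auto simp: \<S>_def intro: borel_closed)
    have bad_lim: "(\<lambda>T. outer_measure_of M (bad T)) \<longlonglongrightarrow> 0"
      unfolding bad_def
    proof (intro outer_measure_of_Un_tendsto_0 outer_measure_of_UN_tendsto_0)
      show "(\<lambda>T. outer_measure_of M N) \<longlonglongrightarrow> 0" using N by simp
      show "(\<lambda>T. outer_measure_of M (bad_F \<delta> T)) \<longlonglongrightarrow> 0"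
        using Fhat_consistent \<delta>(1) unfolding tendsto_zero_in_prob_def bad_F_def by blast
      show "(\<lambda>T. outer_measure_of M (bad_G \<delta> i T)) \<longlonglongrightarrow> 0" for i
        using Ghat_consistent[of i] \<delta>(1) unfolding tendsto_zero_in_prob_def bad_G_def by blast
      show "(\<lambda>T. outer_measure_of M (bad_freq \<tau> S T)) \<longlonglongrightarrow> 0" if "S \<in> \<S>" for S
        unfolding bad_freq_def
        by (rule weak_law_empirical_freq[OF eta_indep eta_ident sets_S[OF that] \<tau>])
    qed (use sets.sets_into_space[OF N(3)] Br in \<open>auto simp: bad_F_def bad_G_def bad_freq_def \<S>_def\<close>)

    \<comment> \<open>Deterministic estimate outside the bad event\<close>
    have good: "\<bar>empirical_cdf m T (normalized_residual (Fhat T (observed T x \<omega>))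
        (Ghat T (observed T x \<omega>)) (\<lambda>t. x t \<omega>)) y - P y\<bar> \<le> \<epsilon>"
      if \<omega>: "\<omega> \<in> space M" "\<omega> \<notin> bad T" for T \<omega> y
    proof -
      define e where "e = normalized_residual (Fhat T (observed T x \<omega>))
        (Ghat T (observed T x \<omega>)) (\<lambda>t. x t \<omega>)"
      \<comment> \<open>The supremum bound holds at every argument at once, hence also at windows
        that depend on \<open>\<omega>\<close>.\<close>
      have F_close: "norm (Fhat T (observed T x \<omega>) Y - F Y) \<le> \<delta>" for Y
        using \<omega> \<delta>(1) by (auto simp: bad_def bad_F_def not_less SUP_le_iff)
      have G_close: "\<bar>Ghat T (observed T x \<omega>) i Y - G i Y\<bar> \<le> \<delta>" for i Y
        using \<omega> \<delta>(1) by (auto simp: bad_def bad_G_def not_less SUP_le_iff)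
      have model: "\<forall>t>CARD('q). x t \<omega> = F (lag_window (\<lambda>u. x u \<omega>) t) + \<zeta> t \<omega>"
        "\<forall>t>m. \<zeta> t \<omega> = diag_matrix (\<lambda>i. G i (lag_window (\<lambda>u. \<zeta> u \<omega>) t)) *v \<eta> t \<omega>"
        using \<omega> N(1) unfolding bad_def by blast+
      have e_close: "\<bar>e t $ i - \<eta> t \<omega> $ i\<bar> \<le> \<rho>"
        if t: "t \<in> {m+1..T}" "norm (\<eta> t \<omega>) \<le> A" for t i
      proof -
        have "\<bar>e t $ i - \<eta> t \<omega> $ i\<bar> \<le> 2 * \<delta> / c * (1 + (1 + L * real CARD('s)) * \<bar>\<eta> t \<omega> $ i\<bar>)"
          unfolding e_def
          by (rule normalized_residual_close[where F = F and G = G and \<zeta> = "\<lambda>t. \<zeta> t \<omega>"])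
             (use model F_close G_close lip L_nonneg c_pos G_ge \<delta> t in \<open>auto simp: m_def\<close>)
        also have "\<dots> \<le> 2 * \<delta> / c * D"
          unfolding D_def using \<delta>(1) c_pos L_nonneg component_le_norm_cart[of "\<eta> t \<omega>" i] t(2)
          by (intro mult_left_mono add_left_mono) auto
        finally show ?thesis using \<delta>(3) by linarith
      qed
      define y' where "y' = truncate_vec (A + 1) y"
      have "y' \<in> K"
        unfolding y'_def K_def using A(1) by (intro truncate_vec_in_cbox) simp
      then obtain l u where lu: "(l, u) \<in> Br" "\<And>i. l $ i \<le> y' $ i - \<rho>" "\<And>i. y' $ i + \<rho> \<le> u $ i"
        and P_lu: "\<bar>P l - P y'\<bar> \<le> \<tau>" "\<bar>P u - P y'\<bar> \<le> \<tau>"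
        using brackets by fastforce
      have P_y': "\<bar>P y' - P y\<bar> \<le> \<tau>"
        using vec_cdf_truncate[OF eta_rv, of A "A + 1" y] A(2) unfolding P_def y'_def by simp
      have freq: "\<bar>empirical_freq m T (\<lambda>t. \<eta> t \<omega>) S - prob {\<omega> \<in> space M. \<eta> 1 \<omega> \<in> S}\<bar> < \<tau>"
        if "S \<in> \<S>" for S
        using \<omega> that by (auto simp: bad_def bad_freq_def not_le)
      have "tail \<in> \<S>" "{..l} \<in> \<S>" "{..u} \<in> \<S>"
        using lu(1) by (force simp: \<S>_def)+
      \<comment> \<open>The tail has probability at most \<open>\<tau>\<close> and its frequency
        deviates by less than \<open>\<tau>\<close>.\<close>
      then have fr: "empirical_freq m T (\<lambda>t. \<eta> t \<omega>) tail < 2 * \<tau>"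
        "\<bar>empirical_freq m T (\<lambda>t. \<eta> t \<omega>) {..l} - P l\<bar> < \<tau>"
        "\<bar>empirical_freq m T (\<lambda>t. \<eta> t \<omega>) {..u} - P u\<bar> < \<tau>"
        using freq[of tail] freq[of "{..l}"] freq[of "{..u}"] A(2)
        by (auto simp: tail_def P_def vec_cdf_def)
      have "A < A + 1" by simp
      note sandwich = empirical_cdf_sandwich[of m T "\<lambda>t. \<eta> t \<omega>" A e \<rho>, OF e_close this
          lu(2)[unfolded y'_def] lu(3)[unfolded y'_def], folded tail_def]
      \<comment> \<open>Both sides pass through the chain: empirical frequency at \<open>u\<close>
        or \<open>l\<close>, then \<open>P\<close> there, then \<open>P y'\<close>, then
        \<open>P y\<close>.\<close>
      have "\<bar>empirical_cdf m T e y - P y\<bar> \<le> 5 * \<tau>"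
        using sandwich fr P_lu P_y' by linarith
      then show ?thesis by (simp add: e_def \<tau>_def)
    qed

    show "(\<lambda>T. outer_measure_of M {\<omega> \<in> space M. (SUP y. ennreal
             \<bar>empirical_cdf (CARD('q) + CARD('s)) T
                (normalized_residual (Fhat T (observed T x \<omega>)) (Ghat T (observed T x \<omega>))
                   (\<lambda>t. x t \<omega>)) y
              - vec_cdf M (\<eta> 1) y\<bar>) > ennreal \<epsilon>}) \<longlonglongrightarrow> 0"
      unfolding m_def[symmetric] P_def[symmetric]
    proof (rule tendsto_sandwich[OF _ _ tendsto_const bad_lim])
      show "\<forall>\<^sub>F T in sequentially. outer_measure_of M {\<omega> \<in> space M. (SUP y. ennreal
             \<bar>empirical_cdf m T
                (normalized_residual (Fhat T (observed T x \<omega>)) (Ghat T (observed T x \<omega>))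
                   (\<lambda>t. x t \<omega>)) y - P y\<bar>) > ennreal \<epsilon>} \<le> outer_measure_of M (bad T)"
      proof (intro always_eventually allI outer_measure_of_mono subsetI)
        fix T \<omega> assume "\<omega> \<in> {\<omega> \<in> space M. (SUP y. ennreal
             \<bar>empirical_cdf m T
                (normalized_residual (Fhat T (observed T x \<omega>)) (Ghat T (observed T x \<omega>))
                   (\<lambda>t. x t \<omega>)) y - P y\<bar>) > ennreal \<epsilon>}"
        \<comment> \<open>A supremum exceeding \<open>\<epsilon>\<close> is witnessed at a single
          \<open>y\<close>, which \<open>good\<close> excludes outside \<open>bad T\<close>.\<close>
        then obtain y where "\<omega> \<in> space M" "ennreal \<epsilon> < ennreal \<bar>empirical_cdf m T
                (normalized_residual (Fhat T (observed T x \<omega>)) (Ghat T (observed T x \<omega>))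
                   (\<lambda>t. x t \<omega>)) y - P y\<bar>"
          by (auto simp: less_SUP_iff)
        then show "\<omega> \<in> bad T" using good ennreal_leI leD by blast
      qed
    qed auto
  qed
qed

end
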